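(* Let $k\geq2$. For every $M\in\{1,2,\dots\}\cup\{\infty\}$ and every $N\in\{0,1,2,\dots\}$, the non-oriented spider-web graph $SW_{k,N,M}$ is weakly isomorphic (isomorphic as graphs, ignoring labels) to the non-oriented Schreier graph $\mathrm{Sch}(\mathcal L_k,H_{N,M},X_k)$.
   Context: Loops and multiple edges allowed. The oriented spider-web graph $\vec{SW}_{k,N,M}$ has vertex set $\{0,\dots,k-1\}^N\times\mathbb Z/M\mathbb Z$ (with $\mathbb Z/\infty\mathbb Z:=\mathbb Z$) and, for each vertex $(x_1\dots x_N,i)$ and each $y\in\{0,\dots,k-1\}$, one edge from $(x_1\dots x_N,i)$ to $(x_2\dots x_Ny,i+1)$; $SW_{k,N,M}$ is its underlying non-oriented graph (each edge gets a formal inverse). $\mathcal L_k=(\mathbb Z/k\mathbb Z)\wr\mathbb Z$, with $b$ the generator of $\mathbb Z$ acting by shift and $c$ the generator of the copy of $\mathbb Z/k\mathbb Z$ at coordinate 0; $X_k=\{c^rb:0\le r\le k-1\}$. Every $g\in\mathcal L_k$ can be written $g=\prod_{t=1}^j(b^{i_t}cb^{-i_t})^{r_t}\cdot b^{r_b}$ with integers $i_t,r_t,r_b$, where $r_b$ is uniquely determined and, for each $i\in\mathbb Z$, $\sum_{t:i_t=i}r_t$ is uniquely determined mod $k$. $H_{N,M}$ is the subgroup of those $g$ with $r_b\equiv0\pmod M$ (meaning $r_b=0$ if $M=\infty$) and, for every $1\le i\le N$, $\sum_{t:\,i_t\equiv i\ (\mathrm{mod}\ N)}r_t\equiv0\pmod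 k$. For $H\le G$ and generating set $S$, the oriented Schreier graph has vertex set the right cosets $Hg$ and an edge labeled $s$ from $Hg$ to $Hgs$ for each $s\in S$; the non-oriented Schreier graph $\mathrm{Sch}(G,H,S)$ is its underlying non-oriented graph. *)

theory Defs
  imports
    "HOL-Algebra.Elementary_Groups"
    "HOL-Algebra.Coset"
    "HOL-Number_Theory.Cong"
    "HOL-Library.Extended_Nat"
    "Graph_Theory.Bidirected_Digraph"
begin

section \<open>Non-oriented graphs\<close>

text \<open>
  An oriented graph (loops and multiple edges allowed) is a pre-digraph. A non-oriented graph is a
  graph in the sense of Serre: a digraph together with a map \<open>arev\<close> sending each arc to its inverse,
  cf. the locale \<^locale>\<open>bidirected_digraph\<close>.
\<close>

type_synonym ('v, 'e) nonoriented_graph = "('v, 'e) pre_digraph \<times> ('e \<Rightarrow> 'e)"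

text \<open>
  \<open>Inl e\<close> is the arc \<open>e\<close> itself, \<open>Inr e\<close> its formal inverse. A loop thus has an inverse different from
  itself. Outside the set of arcs the inversion is the identity, as \<^locale>\<open>bidirected_digraph\<close> requires.
\<close>

definition underlying_graph :: "('v, 'e) pre_digraph \<Rightarrow> ('v, 'e + 'e) nonoriented_graph" where
  "underlying_graph D =
    (\<lparr> verts = verts D,
       arcs = arcs D <+> arcs D,
       tail = case_sum (tail D) (head D),
       head = case_sum (head D) (tail D) \<rparr>,
     \<lambda>a. if a \<in> arcs D <+> arcs D then case_sum Inr Inl a else a)"

lemma bidirected_underlying_graph:
  assumes "wf_digraph D"
  shows "bidirected_digraph (fst (underlying_graph D)) (snd (underlying_graph D))"
proof -
  interpret wf_digraph D by (fact assms)
  show ?thesis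
    by unfold_locales (auto simp: underlying_graph_def split: if_splits sum.splits)
qed

text \<open>
  Existence of an isomorphism of non-oriented graphs. Edge labels are not part of the structure, so
  nothing is required of them.
\<close>

definition weakly_isomorphic ::
    "('v, 'e) nonoriented_graph \<Rightarrow> ('w, 'f) nonoriented_graph \<Rightarrow> bool" where
  "weakly_isomorphic = (\<lambda>(G, inv_G) (H, inv_H).
    \<exists>\<phi> \<psi>. bij_betw \<phi> (verts G) (verts H) \<and> bij_betw \<psi> (arcs G) (arcs H) \<and>
      (\<forall>a \<in> arcs G. tail H (\<psi> a) = \<phi> (tail G a) \<and> head H (\<psi> a) = \<phi> (head G a) \<and>
        \<psi> (inv_G a) = inv_H (\<psi> a)))"

section \<open>Schreier graphs\<close>

text \<open>
  The pair \<open>(C, s)\<close> is the edge from the right coset \<open>C\<close> to \<open>C s\<close> with label \<open>s\<close>.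
\<close>

definition oriented_schreier_graph ::
    "('g, 'm) monoid_scheme \<Rightarrow> 'g set \<Rightarrow> 'g set \<Rightarrow> ('g set, 'g set \<times> 'g) pre_digraph" where
  "oriented_schreier_graph G H S =
    \<lparr> verts = rcosets\<^bsub>G\<^esub> H,
      arcs = (rcosets\<^bsub>G\<^esub> H) \<times> S,
      tail = fst,
      head = (\<lambda>(C, s). C #>\<^bsub>G\<^esub> s) \<rparr>"

definition schreier_graph ::
    "('g, 'm) monoid_scheme \<Rightarrow> 'g set \<Rightarrow> 'g set
      \<Rightarrow> ('g set, 'g set \<times> 'g + 'g set \<times> 'g) nonoriented_graph" where
  "schreier_graph G H S = underlying_graph (oriented_schreier_graph G H S)"

section \<open>Spider-web graphs\<close>

definition integers_mod :: "enat \<Rightarrow> int monoid" where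
  "integers_mod M = (case M of enat m \<Rightarrow> integer_mod_group m | \<infinity> \<Rightarrow> integer_group)"

text \<open>
  The pair \<open>((w, i), y)\<close> is the edge obtained by appending \<open>y\<close> to the word \<open>w\<close>. Appending and then
  deleting the first letter also covers the case \<open>N = 0\<close>, where the empty word is sent to itself.
\<close>

definition oriented_spider_web_graph ::
    "nat \<Rightarrow> nat \<Rightarrow> enat \<Rightarrow> (nat list \<times> int, (nat list \<times> int) \<times> nat) pre_digraph" where
  "oriented_spider_web_graph k N M =
    (let V = {w. length w = N \<and> set w \<subseteq> {..<k}} \<times> carrier (integers_mod M) in
    \<lparr> verts = V,
      arcs = V \<times> {..<k},
      tail = fst,
      head = (\<lambda>((w, i), y). (tl (w @ [y]), i \<otimes>\<^bsub>integers_mod M\<^esub> 1)) \<rparr>)"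

definition spider_web_graph ::
    "nat \<Rightarrow> nat \<Rightarrow> enat \<Rightarrow>
      (nat list \<times> int, (nat list \<times> int) \<times> nat + (nat list \<times> int) \<times> nat) nonoriented_graph" where
  "spider_web_graph k N M = underlying_graph (oriented_spider_web_graph k N M)"

section \<open>Lamplighter groups\<close>

text \<open>
  The restricted wreath product: \<open>B\<close> acts on finitely supported functions \<open>B \<rightarrow> A\<close> by
  left translation.
\<close>

definition wreath_product ::
    "('a, 'm) monoid_scheme \<Rightarrow> ('b, 'n) monoid_scheme \<Rightarrow> (('b \<Rightarrow> 'a) \<times> 'b) monoid"
    (infixl \<open>\<wr>\<close> 75) where
  "A \<wr> B =
    \<lparr> carrier = {f \<in> carrier B \<rightarrow>\<^sub>E carrier A. finite {z \<in> carrier B. f z \<noteq> \<one>\<^bsub>A\<^esub>}} \<times> carrier B,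
      monoid.mult = (\<lambda>(f, x) (g, y).
        (\<lambda>z \<in> carrier B. f z \<otimes>\<^bsub>A\<^esub> g (inv\<^bsub>B\<^esub> x \<otimes>\<^bsub>B\<^esub> z), x \<otimes>\<^bsub>B\<^esub> y)),
      one = (\<lambda>z \<in> carrier B. \<one>\<^bsub>A\<^esub>, \<one>\<^bsub>B\<^esub>) \<rparr>"

lemma group_wreath_product:
  assumes "group A" and "group B"
  shows "group (A \<wr> B)"
proof -
  interpret A: group A by (fact assms)
  interpret B: group B by (fact assms)
  let ?W = "A \<wr> B"
  have supp_shift: "finite {z \<in> carrier B. g (inv\<^bsub>B\<^esub> x \<otimes>\<^bsub>B\<^esub> z) \<noteq> \<one>\<^bsub>A\<^esub>}"
    if "finite {z \<in> carrier B. g z \<noteq> \<one>\<^bsub>A\<^esub>}" "x \<in> carrier B" for g x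
  proof (rule finite_subset)
    show "{z \<in> carrier B. g (inv\<^bsub>B\<^esub> x \<otimes>\<^bsub>B\<^esub> z) \<noteq> \<one>\<^bsub>A\<^esub>}
        \<subseteq> (\<lambda>z. x \<otimes>\<^bsub>B\<^esub> z) ` {z \<in> carrier B. g z \<noteq> \<one>\<^bsub>A\<^esub>}"
    proof
      fix z assume z: "z \<in> {z \<in> carrier B. g (inv\<^bsub>B\<^esub> x \<otimes>\<^bsub>B\<^esub> z) \<noteq> \<one>\<^bsub>A\<^esub>}"
      then have "z = x \<otimes>\<^bsub>B\<^esub> (inv\<^bsub>B\<^esub> x \<otimes>\<^bsub>B\<^esub> z)"
        using that(2) by (simp add: B.m_assoc[symmetric])
      with z that(2) show "z \<in> (\<lambda>z. x \<otimes>\<^bsub>B\<^esub> z) ` {z \<in> carrier B. g z \<noteq> \<one>\<^bsub>A\<^esub>}"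
        by blast
    qed
  qed (use that(1) in simp)
  have closed: "p \<otimes>\<^bsub>?W\<^esub> q \<in> carrier ?W" if "p \<in> carrier ?W" "q \<in> carrier ?W" for p q
  proof -
    obtain f x g y where pq: "p = (f, x)" "q = (g, y)" by fastforce
    have *: "f \<in> carrier B \<rightarrow>\<^sub>E carrier A" "finite {z \<in> carrier B. f z \<noteq> \<one>\<^bsub>A\<^esub>}" "x \<in> carrier B"
      "g \<in> carrier B \<rightarrow>\<^sub>E carrier A" "finite {z \<in> carrier B. g z \<noteq> \<one>\<^bsub>A\<^esub>}" "y \<in> carrier B"
      using that by (auto simp: pq wreath_product_def)
    have "{z \<in> carrier B. f z \<otimes>\<^bsub>A\<^esub> g (inv\<^bsub>B\<^esub> x \<otimes>\<^bsub>B\<^esub> z) \<noteq> \<one>\<^bsub>A\<^esub>}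
        \<subseteq> {z \<in> carrier B. f z \<noteq> \<one>\<^bsub>A\<^esub>} \<union> {z \<in> carrier B. g (inv\<^bsub>B\<^esub> x \<otimes>\<^bsub>B\<^esub> z) \<noteq> \<one>\<^bsub>A\<^esub>}"
      by auto
    then have "finite {z \<in> carrier B. f z \<otimes>\<^bsub>A\<^esub> g (inv\<^bsub>B\<^esub> x \<otimes>\<^bsub>B\<^esub> z) \<noteq> \<one>\<^bsub>A\<^esub>}"
      by (rule finite_subset) (simp add: * supp_shift)
    then show ?thesis
      using * by (auto simp: pq wreath_product_def PiE_iff conj_commute cong: conj_cong)
  qed
  show ?thesis
  proof (rule groupI)
    fix p q r assume c: "p \<in> carrier ?W" "q \<in> carrier ?W" "r \<in> carrier ?W"
    then show "p \<otimes>\<^bsub>?W\<^esub> q \<otimes>\<^bsub>?W\<^esub> r = p \<otimes>\<^bsub>?W\<^esub> (q \<otimes>\<^bsub>?W\<^esub> r)"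
      by (auto simp: wreath_product_def B.m_assoc B.inv_mult_group PiE_iff A.m_assoc
          intro!: restrict_ext)
  next
    show "\<one>\<^bsub>?W\<^esub> \<in> carrier ?W"
      by (auto simp: wreath_product_def)
  next
    fix p assume "p \<in> carrier ?W"
    then show "\<one>\<^bsub>?W\<^esub> \<otimes>\<^bsub>?W\<^esub> p = p"
      by (auto simp: wreath_product_def PiE_iff extensional_def fun_eq_iff)
  next
    fix p assume p: "p \<in> carrier ?W"
    obtain f x where fx: "p = (f, x)" by fastforce
    have *: "f \<in> carrier B \<rightarrow>\<^sub>E carrier A" "finite {z \<in> carrier B. f z \<noteq> \<one>\<^bsub>A\<^esub>}" "x \<in> carrier B"
      using p by (auto simp: fx wreath_product_def)
    let ?q = "(\<lambda>z \<in> carrier B. inv\<^bsub>A\<^esub> f (x \<otimes>\<^bsub>B\<^esub> z), inv\<^bsub>B\<^esub> x)"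
    have "{z \<in> carrier B. inv\<^bsub>A\<^esub> f (x \<otimes>\<^bsub>B\<^esub> z) \<noteq> \<one>\<^bsub>A\<^esub>}
        \<subseteq> {z \<in> carrier B. f (inv\<^bsub>B\<^esub> (inv\<^bsub>B\<^esub> x) \<otimes>\<^bsub>B\<^esub> z) \<noteq> \<one>\<^bsub>A\<^esub>}"
      using * by auto
    then have "finite {z \<in> carrier B. inv\<^bsub>A\<^esub> f (x \<otimes>\<^bsub>B\<^esub> z) \<noteq> \<one>\<^bsub>A\<^esub>}"
      by (rule finite_subset) (rule supp_shift, use * in simp_all)
    then have "?q \<in> carrier ?W"
      using * by (auto simp: wreath_product_def PiE_iff cong: conj_cong)
    moreover have "?q \<otimes>\<^bsub>?W\<^esub> p = \<one>\<^bsub>?W\<^esub>"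
      using * by (auto simp: fx wreath_product_def PiE_iff intro!: restrict_ext)
    ultimately show "\<exists>q \<in> carrier ?W. q \<otimes>\<^bsub>?W\<^esub> p = \<one>\<^bsub>?W\<^esub>"
      by blast
  qed (fact closed)
qed

definition lamplighter_group :: "nat \<Rightarrow> ((int \<Rightarrow> int) \<times> int) monoid" where
  "lamplighter_group k = integer_mod_group k \<wr> integer_group"

text \<open>
  The generators \<open>c\<close> and \<open>b\<close>. The lamp states are the residues \<open>0, \<dots>, k - 1\<close>, so \<open>c\<close> lies in the group
  for \<open>k \<ge> 2\<close>. With left translation, \<open>b\<^bsup>i\<^esup> c b\<^bsup>-i\<^esup>\<close> is the generator of the copy of
  the lamp group at coordinate \<open>i\<close>.
\<close>

definition lamp_gen :: "(int \<Rightarrow> int) \<times> int" where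
  "lamp_gen = (\<lambda>i. if i = 0 then 1 else 0, 0)"

definition shift_gen :: "(int \<Rightarrow> int) \<times> int" where
  "shift_gen = (\<lambda>i. 0, 1)"

definition lamplighter_gens :: "nat \<Rightarrow> ((int \<Rightarrow> int) \<times> int) set" where
  "lamplighter_gens k =
    {lamp_gen [^]\<^bsub>lamplighter_group k\<^esub> r \<otimes>\<^bsub>lamplighter_group k\<^esub> shift_gen | r::nat. r < k}"

text \<open>
  \<open>lamplighter_word k [(i\<^sub>1, r\<^sub>1), \<dots>, (i\<^sub>j, r\<^sub>j)] r\<^sub>b\<close> is the element
  \<open>(b\<^bsup>i\<^sub>1\<^esup> c b\<^bsup>-i\<^sub>1\<^esup>)\<^bsup>r\<^sub>1\<^esup> \<cdots> (b\<^bsup>i\<^sub>j\<^esup> c b\<^bsup>-i\<^sub>j\<^esup>)\<^bsup>r\<^sub>j\<^esup> b\<^bsup>r\<^sub>b\<^esup>\<close>.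
\<close>

definition lamplighter_word :: "nat \<Rightarrow> (int \<times> int) list \<Rightarrow> int \<Rightarrow> (int \<Rightarrow> int) \<times> int" where
  "lamplighter_word k ts rb = (let L = lamplighter_group k in
    foldr (\<lambda>(i, r) g.
        (shift_gen [^]\<^bsub>L\<^esub> i \<otimes>\<^bsub>L\<^esub> lamp_gen \<otimes>\<^bsub>L\<^esub> shift_gen [^]\<^bsub>L\<^esub> (- i)) [^]\<^bsub>L\<^esub> r \<otimes>\<^bsub>L\<^esub> g)
      ts (shift_gen [^]\<^bsub>L\<^esub> rb))"

text \<open>
  The conditions do not depend on the chosen word, as \<open>r\<^sub>b\<close> and the sums of the \<open>r\<^sub>t\<close> with
  \<open>i\<^sub>t = i\<close>, taken modulo \<open>k\<close>, are determined by the element. For \<open>N = 0\<close> only the condition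
  on \<open>r\<^sub>b\<close> remains.
\<close>

definition H_subgroup :: "nat \<Rightarrow> nat \<Rightarrow> enat \<Rightarrow> ((int \<Rightarrow> int) \<times> int) set" where
  "H_subgroup k N M =
    {lamplighter_word k ts rb | ts rb.
      (case M of enat m \<Rightarrow> [rb = 0] (mod int m) | \<infinity> \<Rightarrow> rb = 0) \<and>
      (\<forall>i \<in> {1..N}. [(\<Sum>(j, r) \<leftarrow> filter (\<lambda>(j, r). [j = int i] (mod int N)) ts. r) = 0] (mod int k))}"

end

theory Submission
  imports Defs
begin

text \<open>
  Let \<open>S\<^sub>i(g)\<close> be the sum of the lamps of \<open>g\<close> over the residue class of \<open>i\<close> modulo \<open>N\<close>. Multiplying
  \<open>(g, y)\<close> on the left by an element with cursor shift \<open>x\<close> translates the lamps of \<open>g\<close> by \<open>x\<close> and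
  changes \<open>y\<close> to \<open>x + y\<close>, so the word of the sums \<open>S\<^sub>i\<^sub>+\<^sub>y(g)\<close> modulo \<open>k\<close> with \<open>0 \<le> i < N\<close>, together with
  \<open>y\<close> modulo \<open>M\<close>, is a complete invariant of the right coset of \<open>(g, y)\<close>. Right multiplication by
  \<open>c\<^sup>rb\<close> rotates this word by one letter and adds \<open>r\<close> to the letter that moves to the end. It is thus
  the spider-web edge that appends the former first letter plus \<open>r\<close>; relabelling the edges at each
  vertex by this translation gives the isomorphism.
\<close>

section \<open>Schreier graphs from a complete coset invariant\<close>

text \<open>It suffices to match the oriented arcs: \<open>map_sum \<psi> \<psi>\<close> treats arcs
  and formal inverses alike, so it commutes with exchanging the two copies.\<close>

lemma weakly_isomorphic_underlying_graph:
  assumes "bij_betw \<phi> (verts D) (verts E)" and "bij_betw \<psi> (arcs D) (arcs E)"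
    and "\<And>a. a \<in> arcs D \<Longrightarrow> tail E (\<psi> a) = \<phi> (tail D a)"
    and "\<And>a. a \<in> arcs D \<Longrightarrow> head E (\<psi> a) = \<phi> (head D a)"
  shows "weakly_isomorphic (underlying_graph D) (underlying_graph E)"
proof -
  have "bij_betw (map_sum \<psi> \<psi>) (arcs D <+> arcs D) (arcs E <+> arcs E)"
    unfolding bij_betw_def
  proof
    show "inj_on (map_sum \<psi> \<psi>) (arcs D <+> arcs D)"
      using bij_betw_imp_inj_on[OF assms(2)] by (auto intro!: inj_onI dest: inj_onD)
    show "map_sum \<psi> \<psi> ` (arcs D <+> arcs D) = arcs E <+> arcs E"
      unfolding bij_betw_imp_surj_on[OF assms(2), symmetric] Plus_def
      by (simp add: image_Un image_image)
  qed
  moreover have "\<forall>a \<in> arcs D <+> arcs D. map_sum \<psi> \<psi> a \<in> arcs E <+> arcs E"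
    using bij_betwE[OF assms(2)] by auto
  ultimately show ?thesis
    unfolding weakly_isomorphic_def underlying_graph_def split_conv
    using assms(1) by (intro exI[of _ \<phi>] exI[of _ "map_sum \<psi> \<psi>"]) (auto simp: assms(3,4))
qed

text \<open>Writing \<open>q = (q \<otimes> inv p) \<otimes> p\<close>, the condition on
  \<open>\<sigma>\<close> says that \<open>q\<close> and \<open>p\<close> have equal values exactly
  when \<open>q \<otimes> inv p\<close> lies in \<open>H\<close>.\<close>

lemma (in group) r_coset_eq_fibre:
  assumes "H \<subseteq> carrier G" and "p \<in> carrier G"
    and "\<And>h p. h \<in> carrier G \<Longrightarrow> p \<in> carrier G \<Longrightarrow> \<sigma> (h \<otimes> p) = \<sigma> p \<longleftrightarrow> h \<in> H"
  shows "H #> p = {q \<in> carrier G. \<sigma> q = \<sigma> p}"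
proof (intro equalityI subsetI)
  fix q assume "q \<in> H #> p"
  then show "q \<in> {q \<in> carrier G. \<sigma> q = \<sigma> p}"
    using assms by (auto simp: r_coset_def)
next
  fix q assume q: "q \<in> {q \<in> carrier G. \<sigma> q = \<sigma> p}"
  then have "(q \<otimes> inv p) \<otimes> p = q"
    using assms(2) by (simp add: m_assoc)
  moreover from this have "q \<otimes> inv p \<in> H"
    using assms(2) assms(3)[of "q \<otimes> inv p" p] q by simp
  ultimately show "q \<in> H #> p"
    unfolding r_coset_def by blast
qed

text \<open>A vertex \<open>v\<close> goes to the fibre of \<open>\<sigma>\<close> over it, which is
  a right coset; fibres over distinct vertices are nonempty and disjoint. Since labels are ignored,
  the bijection \<open>e v\<close> from edge labels to generators may vary with the vertex.\<close>

lemma (in group) weakly_isomorphic_schreier_graph: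
  assumes H: "H \<subseteq> carrier G" and S: "S \<subseteq> carrier G"
    and inv: "\<And>h p. h \<in> carrier G \<Longrightarrow> p \<in> carrier G \<Longrightarrow> \<sigma> (h \<otimes> p) = \<sigma> p \<longleftrightarrow> h \<in> H"
    and verts: "\<sigma> ` carrier G = verts D"
    and arcs: "arcs D = verts D \<times> Y"
    and tail: "tail D = fst"
    and bij: "\<And>v. v \<in> verts D \<Longrightarrow> bij_betw (e v) Y S"
    and head: "\<And>p y. p \<in> carrier G \<Longrightarrow> y \<in> Y \<Longrightarrow> head D (\<sigma> p, y) = \<sigma> (p \<otimes> e (\<sigma> p) y)"
  shows "weakly_isomorphic (underlying_graph D) (schreier_graph G H S)"
proof -
  define \<phi> where "\<phi> v = {q \<in> carrier G. \<sigma> q = v}" for v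
  define \<psi> where "\<psi> = (\<lambda>(v, y). (\<phi> v, e v y))"
  have coset: "H #> p = \<phi> (\<sigma> p)" if "p \<in> carrier G" for p
    unfolding \<phi>_def by (rule r_coset_eq_fibre[where \<sigma> = \<sigma>]) (use H that inv in auto)
  have inj: "inj_on \<phi> (verts D)"
  proof (rule inj_onI)
    fix v w assume "v \<in> verts D" "w \<in> verts D" and eq: "\<phi> v = \<phi> w"
    then obtain p where "p \<in> carrier G" "\<sigma> p = v"
      unfolding verts[symmetric] by blast
    then have "p \<in> \<phi> w"
      unfolding eq[symmetric] by (simp add: \<phi>_def)
    then show "v = w"
      using \<open>\<sigma> p = v\<close> by (simp add: \<phi>_def)
  qed
  have img: "\<phi> ` verts D = rcosets H"
    unfolding verts[symmetric] RCOSETS_def image_image UNION_singleton_eq_range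
    by (rule image_cong) (simp_all add: coset)
  have e_in: "e v y \<in> S" if "v \<in> verts D" "y \<in> Y" for v y
    using bij_betwE[OF bij[OF that(1)]] that(2) by blast
  have "bij_betw \<psi> (arcs D) ((rcosets H) \<times> S)"
    unfolding bij_betw_def
  proof
    show "inj_on \<psi> (arcs D)"
    proof (rule inj_onI, clarsimp simp: \<psi>_def arcs)
      fix v y v' y' assume v: "v \<in> verts D" "v' \<in> verts D" and y: "y \<in> Y" "y' \<in> Y"
        and eq: "\<phi> v = \<phi> v'" "e v y = e v' y'"
      have "v = v'"
        using inj_onD[OF inj eq(1) v] .
      moreover from this have "y = y'"
        using inj_onD[OF bij_betw_imp_inj_on[OF bij[OF v(1)]] _ y] eq(2) by simp
      ultimately show "v = v' \<and> y = y'" ..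
    qed
    show "\<psi> ` arcs D = (rcosets H) \<times> S"
    proof (intro equalityI subsetI)
      fix a assume "a \<in> \<psi> ` arcs D"
      then show "a \<in> (rcosets H) \<times> S"
        unfolding img[symmetric] using e_in by (auto simp: \<psi>_def arcs)
    next
      fix a assume "a \<in> (rcosets H) \<times> S"
      then obtain v s where v: "v \<in> verts D" "a = (\<phi> v, s)" "s \<in> S"
        unfolding img[symmetric] by blast
      moreover obtain y where "y \<in> Y" "s = e v y"
        using bij_betw_imp_surj_on[OF bij[OF v(1)]] v(3) by blast
      ultimately show "a \<in> \<psi> ` arcs D"
        by (intro image_eqI[of _ _ "(v, y)"]) (simp_all add: \<psi>_def arcs)
    qed
  qed
  \<comment> \<open>Heads are compared through a representative \<open>p\<close> of the coset
    \<open>\<phi> v\<close>: both sides are the coset of \<open>p \<otimes> e v y\<close>.\<close>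
  moreover have "\<phi> v #> e v y = \<phi> (head D (v, y))" if vy: "v \<in> verts D" "y \<in> Y" for v y
  proof -
    obtain p where p: "p \<in> carrier G" "\<sigma> p = v"
      using vy(1) unfolding verts[symmetric] by blast
    have s: "e v y \<in> carrier G"
      using e_in[OF vy] S by blast
    have "\<phi> v #> e v y = H #> (p \<otimes> e v y)"
      using coset_mult_assoc[OF H p(1) s] coset[OF p(1)] p(2) by simp
    then show ?thesis
      using coset[of "p \<otimes> e v y"] head[OF p(1) vy(2)] p s by simp
  qed
  moreover have "bij_betw \<phi> (verts D) (rcosets H)"
    using inj img by (simp add: bij_betw_def)
  ultimately show ?thesis
    unfolding schreier_graph_def
    by (intro weakly_isomorphic_underlying_graph[of \<phi> _ _ \<psi>])
      (auto simp: oriented_schreier_graph_def tail arcs \<psi>_def)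
qed

section \<open>Elements of the lamplighter group\<close>

lemma group_lamplighter_group: "group (lamplighter_group k)"
  unfolding lamplighter_group_def by (intro group_wreath_product) auto

lemma carrier_lamplighter_group:
  assumes "k > 0"
  shows "(f, x) \<in> carrier (lamplighter_group k) \<longleftrightarrow>
    (\<forall>z. 0 \<le> f z \<and> f z < int k) \<and> finite {z. f z \<noteq> 0}"
  using assms
  by (auto simp: lamplighter_group_def wreath_product_def carrier_integer_mod_group PiE_iff)

lemma mult_lamplighter_group:
  "(f, x) \<otimes>\<^bsub>lamplighter_group k\<^esub> (g, y) = (\<lambda>z. (f z + g (z - x)) mod int k, x + y)"
  by (simp add: lamplighter_group_def wreath_product_def restrict_def)

text \<open>Powers are read off a homomorphism from the additive integers whose value at 1 is the
  base. This treats exponents of both signs at once and is reused for single lamps.\<close>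

lemma shift_gen_int_pow:
  assumes "k > 0"
  shows "shift_gen [^]\<^bsub>lamplighter_group k\<^esub> (i::int) = (\<lambda>_. 0, i)"
proof -
  have "(\<lambda>i. (\<lambda>_. 0, i)) \<in> hom integer_group (lamplighter_group k)"
    using assms by (auto simp: hom_def carrier_lamplighter_group mult_lamplighter_group)
  from hom_int_pow[OF this, of 1 i] show ?thesis
    by (simp add: shift_gen_def group_lamplighter_group)
qed

lemma single_lamp_int_pow:
  assumes "k \<ge> 2"
  shows "(\<lambda>z. if z = i then 1 else 0, 0) [^]\<^bsub>lamplighter_group k\<^esub> (r::int) =
    (\<lambda>z. if z = i then r mod int k else 0, 0)"
proof -
  have "(\<lambda>r. (\<lambda>z. if z = i then r mod int k else 0, 0)) \<in> hom integer_group (lamplighter_group k)"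
    using assms
    by (auto simp: hom_def carrier_lamplighter_group mult_lamplighter_group fun_eq_iff mod_add_eq)
  from hom_int_pow[OF this, of 1 r] show ?thesis
    using assms by (simp add: group_lamplighter_group cong: if_cong)
qed

lemma lamp_gen_conjugate_int_pow:
  assumes "k \<ge> 2"
  shows "(shift_gen [^]\<^bsub>lamplighter_group k\<^esub> i \<otimes>\<^bsub>lamplighter_group k\<^esub> lamp_gen
      \<otimes>\<^bsub>lamplighter_group k\<^esub> shift_gen [^]\<^bsub>lamplighter_group k\<^esub> (- i)) [^]\<^bsub>lamplighter_group k\<^esub> (r::int)
    = (\<lambda>z. if z = i then r mod int k else 0, 0)"
proof -
  have "shift_gen [^]\<^bsub>lamplighter_group k\<^esub> i \<otimes>\<^bsub>lamplighter_group k\<^esub> lamp_gen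
      \<otimes>\<^bsub>lamplighter_group k\<^esub> shift_gen [^]\<^bsub>lamplighter_group k\<^esub> (- i)
    = (\<lambda>z. if z = i then 1 else 0, 0)"
    using assms
    by (auto simp: shift_gen_int_pow lamp_gen_def mult_lamplighter_group fun_eq_iff)
  then show ?thesis
    using single_lamp_int_pow[OF assms] by simp
qed

lemma lamplighter_word_Nil:
  assumes "k > 0"
  shows "lamplighter_word k [] rb = (\<lambda>_. 0, rb)"
  using assms by (simp add: lamplighter_word_def shift_gen_int_pow)

lemma lamplighter_word_Cons:
  assumes "k \<ge> 2"
  shows "lamplighter_word k ((i, r) # ts) rb =
    (\<lambda>z. if z = i then r mod int k else 0, 0) \<otimes>\<^bsub>lamplighter_group k\<^esub> lamplighter_word k ts rb"
  by (simp add: lamplighter_word_def Let_def lamp_gen_conjugate_int_pow[OF assms])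

lemma lamplighter_word_in_carrier:
  assumes "k \<ge> 2"
  shows "lamplighter_word k ts rb \<in> carrier (lamplighter_group k)"
proof (induction ts)
  case Nil
  show ?case
    using assms by (simp add: lamplighter_word_Nil carrier_lamplighter_group)
next
  case (Cons t ts)
  obtain i r where t: "t = (i, r)" by fastforce
  have "(\<lambda>z. if z = i then r mod int k else 0, 0) \<in> carrier (lamplighter_group k)"
    using assms by (simp add: carrier_lamplighter_group)
  with Cons show ?case
    using assms group_lamplighter_group[of k]
    by (simp add: t lamplighter_word_Cons group.is_monoid monoid.m_closed)
qed

lemma snd_lamplighter_word:
  assumes "k \<ge> 2"
  shows "snd (lamplighter_word k ts rb) = rb"
proof (induction ts)
  case (Cons t ts)
  then show ?case
    by (cases t; cases "lamplighter_word k ts rb")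
      (use assms in \<open>simp add: lamplighter_word_Cons mult_lamplighter_group\<close>)
qed (use assms in \<open>simp add: lamplighter_word_Nil\<close>)

text \<open>With one factor per coordinate no two factors touch the same lamp, so nothing
  accumulates.\<close>

lemma lamplighter_word_of_lamps:
  assumes "k \<ge> 2" and "distinct js"
  shows "lamplighter_word k (map (\<lambda>j. (j, f j)) js) rb =
    (\<lambda>z. if z \<in> set js then f z mod int k else 0, rb)"
  using assms(2)
proof (induction js)
  case (Cons j js)
  then show ?case
    using assms(1) by (auto simp: lamplighter_word_Cons mult_lamplighter_group fun_eq_iff)
qed (use assms in \<open>simp add: lamplighter_word_Nil\<close>)

text \<open>Enumerating the finite support of \<open>f\<close> yields a word. It provides the
  witness for membership in \<open>H_subgroup\<close>.\<close>

lemma lamplighter_word_surj: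
  assumes "k \<ge> 2" and "(f, x) \<in> carrier (lamplighter_group k)"
  obtains ts where "(f, x) = lamplighter_word k ts x"
proof
  have f: "0 \<le> f z" "f z < int k" "finite {z. f z \<noteq> 0}" for z
    using assms by (auto simp: carrier_lamplighter_group)
  show "(f, x) = lamplighter_word k (map (\<lambda>j. (j, f j)) (sorted_list_of_set {z. f z \<noteq> 0})) x"
    using f assms(1) by (simp add: lamplighter_word_of_lamps fun_eq_iff)
qed

lemma lamp_gen_pow_mult_shift_gen:
  assumes "k \<ge> 2" and "r < k"
  shows "lamp_gen [^]\<^bsub>lamplighter_group k\<^esub> (r::nat) \<otimes>\<^bsub>lamplighter_group k\<^esub> shift_gen =
    (\<lambda>z. if z = 0 then int r else 0, 1)"
proof -
  have "lamp_gen [^]\<^bsub>lamplighter_group k\<^esub> r = (\<lambda>z. if z = 0 then int r else 0, 0)"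
    using single_lamp_int_pow[OF assms(1), of 0 "int r"] assms(2)
    by (simp add: int_pow_int lamp_gen_def cong: if_cong)
  then show ?thesis
    using assms(2) by (auto simp: shift_gen_def mult_lamplighter_group fun_eq_iff)
qed

section \<open>Sums over residue classes\<close>

text \<open>The unreduced integer version of \<open>S\<^sub>i\<close>, so that additivity and
  translation are exact equations. Restricting to the support makes the sum finite for group
  elements. For \<open>N = 0\<close> congruence is equality, and the value is the single lamp
  \<open>f i\<close>.\<close>

definition class_sum :: "nat \<Rightarrow> (int \<Rightarrow> int) \<Rightarrow> int \<Rightarrow> int" where
  "class_sum N f i = (\<Sum>j | f j \<noteq> 0 \<and> [j = i] (mod int N). f j)"

text \<open>Allows the sums of several functions to run over one common index set.\<close>

lemma class_sum_superset:
  assumes "finite A" and "{j. f j \<noteq> 0} \<subseteq> A"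
  shows "class_sum N f i = (\<Sum>j \<in> {j \<in> A. [j = i] (mod int N)}. f j)"
  unfolding class_sum_def using assms by (intro sum.mono_neutral_left) auto

lemma class_sum_cong_index:
  assumes "[i = i'] (mod int N)"
  shows "class_sum N f i = class_sum N f i'"
  using assms unfolding class_sum_def
  by (intro sum.cong) (auto intro: cong_trans cong_sym)

lemma class_sum_add:
  assumes "finite {j. f j \<noteq> 0}" and "finite {j. g j \<noteq> 0}"
  shows "class_sum N (\<lambda>j. f j + g j) i = class_sum N f i + class_sum N g i"
proof -
  let ?A = "{j. f j \<noteq> 0} \<union> {j. g j \<noteq> 0}"
  have "finite ?A" using assms by simp
  then have "class_sum N h i = (\<Sum>j \<in> {j \<in> ?A. [j = i] (mod int N)}. h j)"
    if "{j. h j \<noteq> 0} \<subseteq> ?A" for h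
    using that by (rule class_sum_superset)
  from this[of f] this[of g] this[of "\<lambda>j. f j + g j"] show ?thesis
    by (simp add: sum.distrib subset_iff)
qed

text \<open>Reducing the values can only shrink the support, so both sums may be taken over the
  support of \<open>f\<close>.\<close>

lemma class_sum_mod:
  assumes "finite {j. f j \<noteq> 0}"
  shows "[class_sum N (\<lambda>j. f j mod n) i = class_sum N f i] (mod n)"
proof -
  have "class_sum N (\<lambda>j. f j mod n) i =
      (\<Sum>j \<in> {j. f j \<noteq> 0} \<inter> {j. [j = i] (mod int N)}. f j mod n)"
    by (subst class_sum_superset[OF assms]) (auto simp: Int_def)
  then show ?thesis
    unfolding class_sum_def by (simp add: cong_def mod_sum_eq Int_def)
qed

lemma class_sum_shift: "class_sum N (\<lambda>j. f (j - x)) i = class_sum N f (i - x)"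
proof -
  have "[j - x = i - x] (mod int N) \<longleftrightarrow> [j = i] (mod int N)" for j
    by (simp add: cong_iff_dvd_diff)
  moreover have "[j + x = i] (mod int N) \<longleftrightarrow> [j = i - x] (mod int N)" for j
    by (simp add: cong_iff_dvd_diff algebra_simps)
  ultimately show ?thesis
    unfolding class_sum_def
    by (intro sum.reindex_bij_witness[of _ "\<lambda>j. j + x" "\<lambda>j. j - x"]) auto
qed

lemma class_sum_single:
  "class_sum N (\<lambda>z. if z = a then r else 0) i = (if [a = i] (mod int N) then r else 0)"
proof -
  have "{j \<in> {a}. [j = i] (mod int N)} = (if [a = i] (mod int N) then {a} else {})"
    by auto
  then show ?thesis
    by (subst class_sum_superset[of "{a}"]) auto
qed

text \<open>The cursor \<open>x\<close> of the left factor translates the lamps of \<open>g\<close>,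
  hence the index \<open>i - x\<close>. Only a congruence holds because the group reduces each lamp
  modulo \<open>k\<close>.\<close>

lemma class_sum_mult:
  assumes "k > 0" and "(f, x) \<in> carrier (lamplighter_group k)"
    and "(g, y) \<in> carrier (lamplighter_group k)"
  shows "[class_sum N (fst ((f, x) \<otimes>\<^bsub>lamplighter_group k\<^esub> (g, y))) i =
    class_sum N f i + class_sum N g (i - x)] (mod int k)"
proof -
  have f: "finite {j. f j \<noteq> 0}" and g: "finite {j. g j \<noteq> 0}"
    using assms by (auto simp: carrier_lamplighter_group)
  have "{j. g (j - x) \<noteq> 0} \<subseteq> (\<lambda>j. j + x) ` {j. g j \<noteq> 0}"
    by (force simp: image_iff)
  then have g': "finite {j. g (j - x) \<noteq> 0}"
    using g by (rule finite_surj[rotated])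
  have "finite {j. f j + g (j - x) \<noteq> 0}"
    by (rule finite_subset[OF _ finite_UnI[OF f g']]) auto
  from class_sum_mod[OF this, of N "int k" i] show ?thesis
    by (simp add: mult_lamplighter_group class_sum_add[OF f g'] class_sum_shift)
qed

text \<open>Each factor of the word has cursor 0 and does not translate what follows, so its
  exponent is simply added to the class of its coordinate.\<close>

lemma class_sum_lamplighter_word:
  assumes "k \<ge> 2"
  shows "[class_sum N (fst (lamplighter_word k ts rb)) i =
    (\<Sum>(j, r) \<leftarrow> filter (\<lambda>(j, r). [j = i] (mod int N)) ts. r)] (mod int k)"
proof (induction ts)
  case Nil
  show ?case
    using assms by (simp add: lamplighter_word_Nil class_sum_def)
next
  case (Cons t ts)
  obtain j r where t: "t = (j, r)" by fastforce
  obtain g y where g: "lamplighter_word k ts rb = (g, y)" by fastforce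
  let ?c = "(\<lambda>z. if z = j then r mod int k else 0, 0)"
  have "[class_sum N (fst (lamplighter_word k (t # ts) rb)) i =
      class_sum N (fst ?c) i + class_sum N g i] (mod int k)"
    using class_sum_mult[of k "fst ?c" 0 g y N i] assms lamplighter_word_in_carrier[OF assms, of ts rb]
    by (simp add: t g lamplighter_word_Cons carrier_lamplighter_group)
  also have "[class_sum N (fst ?c) i + class_sum N g i =
      (if [j = i] (mod int N) then r else 0) +
      (\<Sum>(j, r) \<leftarrow> filter (\<lambda>(j, r). [j = i] (mod int N)) ts. r)] (mod int k)"
    by (rule cong_add) (use Cons in \<open>auto simp: g class_sum_single\<close>)
  finally show ?case
    by (simp add: t split: if_splits)
qed

text \<open>Class sums depend on the element alone, which frees membership from the choice of a
  word: every word for \<open>(f, x)\<close> has tallies congruent to them and final exponent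
  \<open>x\<close>.\<close>

lemma H_subgroup_iff:
  assumes "k \<ge> 2" and "(f, x) \<in> carrier (lamplighter_group k)"
  shows "(f, x) \<in> H_subgroup k N M \<longleftrightarrow>
    [x = 0] (mod int (case M of enat m \<Rightarrow> m | \<infinity> \<Rightarrow> 0)) \<and>
    (\<forall>i \<in> {1..N}. [class_sum N f (int i) = 0] (mod int k))" (is "_ \<longleftrightarrow> ?R")
proof -
  \<comment> \<open>Congruence modulo 0 is equality, so \<open>\<infinity>\<close> becomes the
    modulus 0.\<close>
  have M: "(case M of enat m \<Rightarrow> [rb = 0] (mod int m) | \<infinity> \<Rightarrow> rb = 0) \<longleftrightarrow>
      [rb = 0] (mod int (case M of enat m \<Rightarrow> m | \<infinity> \<Rightarrow> 0))" for rb
    by (cases M) auto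
  have sums: "[(\<Sum>(j, r) \<leftarrow> filter (\<lambda>(j, r). [j = i] (mod int N)) ts. r) = 0] (mod int k) \<longleftrightarrow>
      [class_sum N f i = 0] (mod int k)" if "(f, x) = lamplighter_word k ts rb" for ts rb i
    using class_sum_lamplighter_word[OF assms(1), of N ts rb i] that[symmetric]
    by (auto intro: cong_trans cong_sym)
  show ?thesis
  proof
    assume "(f, x) \<in> H_subgroup k N M"
    then obtain ts rb where ts: "(f, x) = lamplighter_word k ts rb"
      "[rb = 0] (mod int (case M of enat m \<Rightarrow> m | \<infinity> \<Rightarrow> 0))"
      "\<forall>i \<in> {1..N}. [(\<Sum>(j, r) \<leftarrow> filter (\<lambda>(j, r). [j = int i] (mod int N)) ts. r) = 0] (mod int k)"
      unfolding H_subgroup_def M by blast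
    moreover have "x = rb"
      using snd_lamplighter_word[OF assms(1), of ts rb] ts(1)[symmetric] by simp
    ultimately show ?R
      using sums[OF ts(1)] by blast
  next
    assume R: ?R
    obtain ts where ts: "(f, x) = lamplighter_word k ts x"
      using lamplighter_word_surj[OF assms] .
    show "(f, x) \<in> H_subgroup k N M"
      unfolding H_subgroup_def M using R ts sums[OF ts] by blast
  qed
qed

section \<open>The coset invariant\<close>

text \<open>
  As \<open>x mod 0 = x\<close> and \<open>integer_mod_group 0 = integer_group\<close>, the case \<open>M = \<infinity>\<close> is the modulus \<open>m = 0\<close>.
\<close>

definition web_state :: "nat \<Rightarrow> nat \<Rightarrow> nat \<Rightarrow> (int \<Rightarrow> int) \<times> int \<Rightarrow> nat list \<times> int" where
  "web_state k N m = (\<lambda>(g, y).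
    (map (\<lambda>i. nat (class_sum N g (int i + y) mod int k)) [0..<N], y mod int m))"

text \<open>Any \<open>N\<close> consecutive integers represent all residue classes modulo
  \<open>N\<close>. This reconciles the window of \<open>web_state\<close>, which starts at the
  cursor, with the range \<open>{1..N}\<close> in the subgroup.\<close>

lemma all_residues_iff:
  assumes "\<And>i j. [i = j] (mod int N) \<Longrightarrow> P i = P j"
  shows "(\<forall>i<N. P (int i + a)) \<longleftrightarrow> (\<forall>i \<in> {1..N}. P (int i))"
proof (cases "N = 0")
  case False
  have shift: "\<exists>l<N. [int l + b = z] (mod int N)" for b z
    using False
    by (intro exI[of _ "nat ((z - b) mod int N)"])
      (auto simp: nat_less_iff cong_def mod_simps)
  have "(\<forall>i<N. P (int i + b)) \<longleftrightarrow> (\<forall>z. P z)" for b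
    using shift assms by blast
  \<comment> \<open>The windows starting at \<open>a\<close> and at 1 are both equivalent to
    \<open>P\<close> holding everywhere; the second one is \<open>{1..N}\<close>.\<close>
  note this[of a] this[of 1]
  moreover have "(\<forall>i<N. P (int i + 1)) \<longleftrightarrow> (\<forall>i \<in> {1..N}. P (int i))"
  proof -
    have "{1..N} = Suc ` {..<N}"
      by (simp add: lessThan_atLeast0 image_Suc_atLeastLessThan atLeastLessThanSuc_atLeastAtMost)
    then show ?thesis
      by (auto simp: add.commute)
  qed
  ultimately show ?thesis by blast
qed simp

text \<open>Indexing letters relative to the cursor cancels the translation by
  \<open>h = (f, x)\<close>: at \<open>i + (x + y)\<close> the product has the class sum of
  \<open>f\<close> there plus that of \<open>g\<close> at \<open>i + y\<close>. Whether the state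
  changes thus depends on \<open>h\<close> alone.\<close>

lemma web_state_mult_eq_iff:
  assumes k: "k \<ge> 2" and h: "h \<in> carrier (lamplighter_group k)"
    and p: "p \<in> carrier (lamplighter_group k)"
  defines "m \<equiv> \<lambda>M. case M of enat m \<Rightarrow> m | \<infinity> \<Rightarrow> 0"
  shows "web_state k N (m M) (h \<otimes>\<^bsub>lamplighter_group k\<^esub> p) = web_state k N (m M) p \<longleftrightarrow>
    h \<in> H_subgroup k N M"
proof -
  obtain f x g y where hp: "h = (f, x)" "p = (g, y)" by fastforce
  define s where "s = fst (h \<otimes>\<^bsub>lamplighter_group k\<^esub> p)"
  have s: "h \<otimes>\<^bsub>lamplighter_group k\<^esub> p = (s, x + y)"
    by (simp add: s_def hp mult_lamplighter_group)
  have *: "nat (class_sum N s (int i + (x + y)) mod int k) = nat (class_sum N g (int i + y) mod int k)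
      \<longleftrightarrow> [class_sum N f (int i + (x + y)) = 0] (mod int k)" for i
  proof -
    have "[class_sum N s (int i + (x + y)) =
        class_sum N f (int i + (x + y)) + class_sum N g (int i + (x + y) - x)] (mod int k)"
      using class_sum_mult[of k f x g y N "int i + (x + y)"] k h p by (simp add: s_def hp)
    moreover have "int i + (x + y) - x = int i + y" by simp
    ultimately have c: "[class_sum N s (int i + (x + y)) =
        class_sum N f (int i + (x + y)) + class_sum N g (int i + y)] (mod int k)"
      by metis
    have "nat (class_sum N s (int i + (x + y)) mod int k) = nat (class_sum N g (int i + y) mod int k)
        \<longleftrightarrow> [class_sum N s (int i + (x + y)) = class_sum N g (int i + y)] (mod int k)"
      using k by (simp add: cong_def eq_nat_nat_iff)
    also have "\<dots> \<longleftrightarrow> [class_sum N f (int i + (x + y)) + class_sum N g (int i + y)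
        = class_sum N g (int i + y)] (mod int k)"
      using c by (meson cong_trans cong_sym)
    finally show ?thesis
      by (simp add: cong_add_rcancel_0)
  qed
  have "web_state k N (m M) (h \<otimes>\<^bsub>lamplighter_group k\<^esub> p) = web_state k N (m M) p \<longleftrightarrow>
      (\<forall>i<N. [class_sum N f (int i + (x + y)) = 0] (mod int k)) \<and> [x + y = y] (mod int (m M))"
    unfolding s by (auto simp: hp web_state_def * cong_def)
  also have "(\<forall>i<N. [class_sum N f (int i + (x + y)) = 0] (mod int k)) \<longleftrightarrow>
      (\<forall>i \<in> {1..N}. [class_sum N f (int i) = 0] (mod int k))"
    by (rule all_residues_iff) (simp add: class_sum_cong_index)
  finally show ?thesis
    using H_subgroup_iff[OF k, of f x N M] h
    by (auto simp: hp m_def cong_add_rcancel_0)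
qed

lemma web_state_image:
  assumes "k > 0"
  shows "web_state k N m ` carrier (lamplighter_group k) =
    {w. length w = N \<and> set w \<subseteq> {..<k}} \<times> carrier (integer_mod_group m)" (is "_ = ?V")
proof (intro equalityI subsetI)
  fix v assume "v \<in> web_state k N m ` carrier (lamplighter_group k)"
  then show "v \<in> ?V"
    using assms by (auto simp: web_state_def carrier_integer_mod_group nat_less_iff)
next
  fix v assume "v \<in> ?V"
  then obtain w i where v: "v = (w, i)" "length w = N" "set w \<subseteq> {..<k}"
    "i \<in> carrier (integer_mod_group m)" by auto
  \<comment> \<open>The letters are written on the \<open>N\<close> consecutive lamps starting at
    the cursor \<open>i\<close>. This window meets each residue class once, so each class sum is a
    single letter.\<close>
  define f where "f z = (if i \<le> z \<and> z < i + int N then int (w ! nat (z - i)) else 0)" for z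
  have supp: "{z. f z \<noteq> 0} \<subseteq> {i..<i + int N}"
    by (auto simp: f_def)
  have w: "w ! j < k" if "j < N" for j
    using v that by (metis lessThan_iff nth_mem subsetD)
  have "class_sum N f (int j + i) = int (w ! j)" if j: "j < N" for j
  proof -
    have "{z \<in> {i..<i + int N}. [z = int j + i] (mod int N)} = {int j + i}"
    proof (intro equalityI subsetI)
      fix z assume z: "z \<in> {z \<in> {i..<i + int N}. [z = int j + i] (mod int N)}"
      then have "[z - i = int j] (mod int N)"
        by (simp add: cong_iff_dvd_diff algebra_simps)
      then have "z - i = int j"
        using z j by (intro cong_less_imp_eq_int) auto
      then show "z \<in> {int j + i}" by simp
    qed (use j in auto)
    moreover have "f (int j + i) = int (w ! j)"
      using j by (simp add: f_def)
    ultimately show ?thesis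
      using class_sum_superset[OF _ supp, of N "int j + i"] by simp
  qed
  then have "web_state k N m (f, i) = v"
    using v w by (auto simp: web_state_def carrier_integer_mod_group intro!: nth_equalityI split: if_splits)
  moreover have "(f, i) \<in> carrier (lamplighter_group k)"
    using assms finite_subset[OF supp] by (auto simp: carrier_lamplighter_group f_def intro!: w)
  ultimately show "v \<in> web_state k N m ` carrier (lamplighter_group k)"
    by blast
qed

section \<open>Matching generators with spider-web edges\<close>

definition first_letter :: "nat list \<Rightarrow> nat" where
  "first_letter w = (case w of [] \<Rightarrow> 0 | a # _ \<Rightarrow> a)"

text \<open>The generator \<open>c\<^sup>r b\<close> with \<open>r\<close> equal to \<open>y\<close>
  minus the first letter, because right multiplication adds \<open>r\<close> to that letter as it
  moves to the end. For \<open>N = 0\<close> the default letter 0 makes \<open>y\<close> itself the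
  exponent.\<close>

definition edge_gen :: "nat \<Rightarrow> nat list \<times> int \<Rightarrow> nat \<Rightarrow> (int \<Rightarrow> int) \<times> int" where
  "edge_gen k v y = (\<lambda>z. if z = 0 then (int y - int (first_letter (fst v))) mod int k else 0, 1)"

lemma lamplighter_gens_eq:
  assumes "k \<ge> 2"
  shows "lamplighter_gens k = (\<lambda>r. (\<lambda>z. if z = 0 then r else 0, 1)) ` {0..<int k}"
proof -
  have "lamplighter_gens k =
      (\<lambda>r. lamp_gen [^]\<^bsub>lamplighter_group k\<^esub> r \<otimes>\<^bsub>lamplighter_group k\<^esub> shift_gen) ` {..<k}"
    unfolding lamplighter_gens_def by auto
  also have "\<dots> = (\<lambda>r. (\<lambda>z. if z = 0 then int r else 0, 1)) ` {..<k}"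
    by (rule image_cong) (simp_all add: lamp_gen_pow_mult_shift_gen[OF assms])
  also have "\<dots> = (\<lambda>r. (\<lambda>z. if z = 0 then r else 0, 1)) ` int ` {..<k}"
    by (simp add: image_image)
  finally show ?thesis
    by (simp add: image_int_atLeastLessThan lessThan_atLeast0)
qed

text \<open>Translation by a fixed letter permutes the residues modulo \<open>k\<close>, and these
  correspond to the generators.\<close>

lemma bij_betw_edge_gen:
  assumes "k \<ge> 2"
  shows "bij_betw (edge_gen k v) {..<k} (lamplighter_gens k)"
proof -
  let ?a = "int (first_letter (fst v))"
  have "bij_betw (\<lambda>y. (int y - ?a) mod int k) {..<k} {0..<int k}"
    by (rule bij_betw_byWitness[of _ "\<lambda>r. nat ((r + ?a) mod int k)"])
      (use assms in \<open>auto simp: mod_simps nat_less_iff\<close>)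
  moreover have "bij_betw (\<lambda>r. (\<lambda>z::int. if z = 0 then r else 0, 1::int)) {0..<int k} (lamplighter_gens k)"
    by (auto simp: lamplighter_gens_eq[OF assms] bij_betw_def inj_on_def fun_eq_iff split: if_splits)
  ultimately show ?thesis
    by (auto dest: bij_betw_trans simp: comp_def edge_gen_def[abs_def])
qed

text \<open>Advancing the cursor shifts the window by one, so the class of \<open>x\<close> passes
  from the first letter to the last. The lamp of the generator lands in exactly this class, where it
  replaces the old letter by \<open>y\<close>.\<close>

lemma web_state_mult_edge_gen:
  assumes k: "k > 0" and p: "p \<in> carrier (lamplighter_group k)" and y: "y < k"
  shows "web_state k N m (p \<otimes>\<^bsub>lamplighter_group k\<^esub> edge_gen k (web_state k N m p) y) =
    (tl (fst (web_state k N m p) @ [y]), (snd (web_state k N m p) + 1) mod int m)"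
proof -
  obtain g x where gx: "p = (g, x)" by fastforce
  define a where "a = int (first_letter (fst (web_state k N m p)))"
  define c where "c = (\<lambda>z::int. if z = 0 then (int y - a) mod int k else 0)"
  define s where "s = fst (p \<otimes>\<^bsub>lamplighter_group k\<^esub> (c, 1))"
  have e: "edge_gen k (web_state k N m p) y = (c, 1)"
    unfolding edge_gen_def c_def a_def ..
  have s: "p \<otimes>\<^bsub>lamplighter_group k\<^esub> (c, 1) = (s, x + 1)"
    by (simp add: s_def gx mult_lamplighter_group)
  have "(c, 1) \<in> carrier (lamplighter_group k)"
    using k by (auto simp: c_def carrier_lamplighter_group)
  \<comment> \<open>The lamp of \<open>c\<close> at 0 is carried to the cursor position
    \<open>x\<close>, so only the class of \<open>x\<close> changes.\<close>
  then have sum: "[class_sum N s i = class_sum N g i +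
      (if [0 = i - x] (mod int N) then (int y - a) mod int k else 0)] (mod int k)" for i
    using class_sum_mult[OF k, of g x c 1 N i] p by (simp add: s_def gx c_def class_sum_single)
  have entry: "nat (class_sum N s (int i + (x + 1)) mod int k) =
      tl (fst (web_state k N m p) @ [y]) ! i" if i: "i < N" for i
  proof (cases "Suc i = N")
    case True
    \<comment> \<open>Last letter: the index \<open>int i + (x + 1)\<close> is \<open>x + N\<close>,
      in the class of \<open>x\<close>, and adding \<open>y - a\<close> to the old letter
      \<open>a\<close> leaves \<open>y\<close>.\<close>
    then have N: "int N = int i + 1" by simp
    have "a = class_sum N g x mod int k"
      using i k by (simp add: a_def first_letter_def gx web_state_def upt_conv_Cons)
    moreover have "class_sum N g (int i + (x + 1)) = class_sum N g x"
      by (rule class_sum_cong_index) (simp add: N cong_iff_dvd_diff)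
    moreover have "[0 = int i + (x + 1) - x] (mod int N)"
      by (simp add: N cong_def)
    ultimately have "[class_sum N s (int i + (x + 1)) = int y] (mod int k)"
      using sum[of "int i + (x + 1)"] by (simp add: cong_def mod_simps)
    then have "nat (class_sum N s (int i + (x + 1)) mod int k) = y"
      using y by (simp add: cong_def)
    moreover have "tl (fst (web_state k N m p) @ [y]) ! i = y"
      using True by (auto simp: nth_tl nth_append gx web_state_def)
    ultimately show ?thesis by simp
  next
    case False
    \<comment> \<open>Here \<open>0 < i + 1 < N\<close>, so the generator misses this class and the
      old letter number \<open>Suc i\<close> moves to position \<open>i\<close>.\<close>
    then have "\<not> [0 = int i + (x + 1) - x] (mod int N)"
      using i by (auto simp: cong_def)
    then have "[class_sum N s (int i + (x + 1)) = class_sum N g (int (Suc i) + x)] (mod int k)"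
      using sum[of "int i + (x + 1)"] by (simp add: algebra_simps)
    then show ?thesis
      using False i by (simp add: nth_tl nth_append gx web_state_def cong_def)
  qed
  have "map (\<lambda>i. nat (class_sum N s (int i + (x + 1)) mod int k)) [0..<N] =
      tl (fst (web_state k N m p) @ [y])"
    by (rule nth_equalityI) (use entry in \<open>auto simp: gx web_state_def\<close>)
  then show ?thesis
    unfolding e s by (simp add: gx web_state_def mod_simps)
qed

theorem theorem6p3:
  fixes k N :: nat and M :: enat
  assumes "k \<ge> 2" and "M \<ge> 1"
  shows "weakly_isomorphic (spider_web_graph k N M)
    (schreier_graph (lamplighter_group k) (H_subgroup k N M) (lamplighter_gens k))"
proof -
  define m where "m = (case M of enat m \<Rightarrow> m | \<infinity> \<Rightarrow> 0)"
  have M: "integers_mod M = integer_mod_group m"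
    by (cases M) (auto simp: integers_mod_def m_def integer_mod_group_def)
  interpret group "lamplighter_group k"
    by (rule group_lamplighter_group)
  show ?thesis
    unfolding spider_web_graph_def
  proof (rule weakly_isomorphic_schreier_graph[where \<sigma> = "web_state k N m" and e = "edge_gen k"
        and Y = "{..<k}"])
    show "H_subgroup k N M \<subseteq> carrier (lamplighter_group k)"
      using lamplighter_word_in_carrier[OF assms(1)] unfolding H_subgroup_def by blast
    show "lamplighter_gens k \<subseteq> carrier (lamplighter_group k)"
      using assms(1) by (auto simp: lamplighter_gens_eq carrier_lamplighter_group)
  next
    fix h p assume "h \<in> carrier (lamplighter_group k)" "p \<in> carrier (lamplighter_group k)"
    then show "web_state k N m (h \<otimes>\<^bsub>lamplighter_group k\<^esub> p) = web_state k N m p \<longleftrightarrow>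
        h \<in> H_subgroup k N M"
      unfolding m_def by (rule web_state_mult_eq_iff[OF assms(1)])
  next
    fix p y assume "p \<in> carrier (lamplighter_group k)" "y \<in> {..<k}"
    then show "head (oriented_spider_web_graph k N M) (web_state k N m p, y) =
        web_state k N m (p \<otimes>\<^bsub>lamplighter_group k\<^esub> edge_gen k (web_state k N m p) y)"
      using assms(1) web_state_mult_edge_gen[of k p y N m]
      by (simp add: oriented_spider_web_graph_def M Let_def split_beta)
  qed (use assms(1) in \<open>simp_all add: web_state_image oriented_spider_web_graph_def M Let_def
      bij_betw_edge_gen\<close>)
qed

end
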